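(* Let $\mathbb{F}_q$ be a finite field, let $W$ be a weighing matrix $\mathrm{W}(n,m)$, and let $G=[\,W\mid I_n\,]$ over $\mathbb{F}_q$. If $m+1\neq 0$ in $\mathbb{F}_q$, then $G$ generates an LCD code $C$ of length $2n$ and dimension $n$ over $\mathbb{F}_q$.
   Context: A weighing matrix $\mathrm{W}(n,m)$ is an $n\times n$ matrix $W$ with entries in $\{0,1,-1\}$ such that $WW^{\top}=mI_n$ over $\mathbb{C}$. Entries $0,\pm1$ and integers are interpreted in $\mathbb{F}_q$. A matrix over $\mathbb{F}_q$ generates the linear code spanned by its rows. For a linear code $C\subseteq\mathbb{F}_q^N$, $C^\perp$ is its orthogonal complement under the standard inner product, and $C$ is LCD if $C\cap C^\perp=\{0\}$. *)

theory Defs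
  imports "HOL.Complex" "Jordan_Normal_Form.VS_Connect"
begin

text \<open>The matrix is kept over the integers so that its entries can be read both in the complex
  numbers (for the defining equation) and in an arbitrary field.\<close>
definition weighing_matrix :: "nat \<Rightarrow> nat \<Rightarrow> int mat \<Rightarrow> bool" where
  "weighing_matrix n m W \<longleftrightarrow>
     W \<in> carrier_mat n n \<and> elements_mat W \<subseteq> {0, 1, -1} \<and>
     (let W' = map_mat (of_int :: int \<Rightarrow> complex) W
      in W' * transpose_mat W' = of_nat m \<cdot>\<^sub>m 1\<^sub>m n)"

text \<open>The block matrix \<open>[A | B]\<close>, defined like the library's \<open>append_rows\<close>.\<close>
definition append_cols :: "'a :: zero mat \<Rightarrow> 'a mat \<Rightarrow> 'a mat" (infixr \<open>@\<^sub>c\<close> 65) where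
  "A @\<^sub>c B = four_block_mat A B (0\<^sub>m 0 (dim_col A)) (0\<^sub>m 0 (dim_col B))"

definition linear_code :: "nat \<Rightarrow> 'a :: {field,finite} vec set \<Rightarrow> bool" where
  "linear_code N C \<longleftrightarrow> VectorSpace.subspace class_ring C (module_vec TYPE('a) N)"

definition code_dim :: "nat \<Rightarrow> 'a :: {field,finite} vec set \<Rightarrow> nat" where
  "code_dim N C = vectorspace.dim class_ring ((module_vec TYPE('a) N)\<lparr>carrier := C\<rparr>)"

definition generated_code :: "'a :: {field,finite} mat \<Rightarrow> 'a vec set" where
  "generated_code G = vec_space.row_space (dim_col G) G"

text \<open>The library's \<open>orthogonal_complement\<close> is taken with respect to the standard bilinear form,
  without conjugation.\<close>
definition dual_code :: "nat \<Rightarrow> 'a :: {field,finite} vec set \<Rightarrow> 'a vec set" where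
  "dual_code N C = vec_module.orthogonal_complement N C"

definition LCD_code :: "nat \<Rightarrow> 'a :: {field,finite} vec set \<Rightarrow> bool" where
  "LCD_code N C \<longleftrightarrow> linear_code N C \<and> C \<inter> dual_code N C = {0\<^sub>v N}"

end

(* By Massey's criterion a code with generator matrix G is LCD of full dimension as soon as
   G G^T is nonsingular: a codeword G^T y orthogonal to all rows of G satisfies (G G^T) y = 0,
   whence y = 0. For G = [W | I] one has G G^T = W W^T + I = (m + 1) I. *)

theory Submission
  imports Defs "Jordan_Normal_Form.DL_Rank"
begin

text \<open>If columns i and j agreed for distinct i and j, the difference of the i-th and j-th unit
  vectors would be a nonzero kernel vector.\<close>

lemma distinct_cols_if_kernel_trivial:
  fixes A :: "'a :: comm_ring_1 mat"
  assumes A: "A \<in> carrier_mat nr nc"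
    and ker: "\<And>v. v \<in> carrier_vec nc \<Longrightarrow> A *\<^sub>v v = 0\<^sub>v nr \<Longrightarrow> v = 0\<^sub>v nc"
  shows "distinct (cols A)"
  unfolding distinct_conv_nth
proof (intro allI impI)
  fix i j assume "i < length (cols A)" "j < length (cols A)" and ij: "i \<noteq> j"
  then have i: "i < nc" and j: "j < nc" using A by auto
  let ?v = "unit_vec nc i - unit_vec nc j :: 'a vec"
  show "cols A ! i \<noteq> cols A ! j"
  proof
    assume "cols A ! i = cols A ! j"
    then have "col A i = col A j" using i j A by simp
    moreover have "A *\<^sub>v ?v = A *\<^sub>v unit_vec nc i - A *\<^sub>v unit_vec nc j"
      by (rule mult_minus_distrib_mat_vec[OF A]) auto
    moreover have "A *\<^sub>v unit_vec nc l = col A l" if "l < nc" for l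
      using that A by (intro eq_vecI) auto
    ultimately have "A *\<^sub>v ?v = 0\<^sub>v nr" using i j A by auto
    then have "?v = 0\<^sub>v nc" using ker[of ?v] by simp
    then have "?v $ i = 0" using i by simp
    then show False using i j ij by simp
  qed
qed

lemma mult_mat_vec_zero:
  fixes A :: "'a :: semiring_0 mat"
  assumes "A \<in> carrier_mat nr nc"
  shows "A *\<^sub>v 0\<^sub>v nc = 0\<^sub>v nr"
  using assms by (intro eq_vecI) auto

text \<open>A dependence among the columns is a nonzero kernel vector. Independence is stated for
  the set of columns, which forgets repetitions, so distinctness has to be secured first.\<close>

lemma (in vec_space) rank_eq_dim_col_if_kernel_trivial:
  assumes A: "A \<in> carrier_mat n nc"
    and ker: "\<And>v. v \<in> carrier_vec nc \<Longrightarrow> A *\<^sub>v v = 0\<^sub>v n \<Longrightarrow> v = 0\<^sub>v nc"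
  shows "rank A = nc"
proof -
  have dist: "distinct (cols A)" using A ker by (rule distinct_cols_if_kernel_trivial)
  then have "lin_indpt (set (cols A))" using lin_depE[OF A] ker by metis
  with dist show ?thesis using lin_indpt_full_rank[OF A] by blast
qed

theorem Massey_LCD_criterion:
  fixes G :: "'a :: {field,finite} mat"
  assumes G: "G \<in> carrier_mat k N"
    and det: "det (G * G\<^sup>T) \<noteq> 0"
  shows "LCD_code N (generated_code G)" and "code_dim N (generated_code G) = k"
proof -
  interpret vec_space "TYPE('a)" N .
  let ?C = "generated_code G"
  have GT: "G\<^sup>T \<in> carrier_mat N k" using G by simp
  have Gram: "G * G\<^sup>T \<in> carrier_mat k k" using G by simp
  \<comment> \<open>Two views of one code: the span serves the subspace and dimension claims, the
    image below writes each codeword as \<open>G\<^sup>T *\<^sub>v y\<close>.\<close>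
  have C_span: "?C = span (set (cols G\<^sup>T))"
    using G by (simp add: generated_code_def row_space_def)
  have C_image: "?C = {w \<in> carrier_vec N. \<exists>y \<in> carrier_vec k. G\<^sup>T *\<^sub>v y = w}"
    using G row_space_eq[OF G] by (simp add: generated_code_def)
  have Gram_ker: "y = 0\<^sub>v k" if y: "y \<in> carrier_vec k" and "G *\<^sub>v (G\<^sup>T *\<^sub>v y) = 0\<^sub>v k" for y
    using det det_0_iff_vec_prod_zero_field[OF Gram] that assoc_mult_mat_vec[OF G GT y] by auto
  \<comment> \<open>Multiplying by \<open>G\<close> reduces injectivity of \<open>G\<^sup>T\<close>
    to that of the Gram matrix.\<close>
  have ker: "y = 0\<^sub>v k" if "y \<in> carrier_vec k" "G\<^sup>T *\<^sub>v y = 0\<^sub>v N" for y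
    using Gram_ker[OF that(1)] that(2) mult_mat_vec_zero[OF G] by simp
  show "code_dim N ?C = k"
    \<comment> \<open>The dimension of the span of the columns of \<open>G\<^sup>T\<close> is by
      definition the rank of \<open>G\<^sup>T\<close>.\<close>
    using rank_eq_dim_col_if_kernel_trivial[OF GT ker]
    by (simp add: code_dim_def C_span rank_def)
  have cols: "set (cols G\<^sup>T) \<subseteq> carrier_vec N" using GT cols_dim by blast
  have sub: "linear_code N ?C"
    using span_is_subspace[of "set (cols G\<^sup>T)"] cols
    by (simp add: linear_code_def C_span)
  have "x = 0\<^sub>v N" if "x \<in> ?C" and orth: "x \<in> dual_code N ?C" for x
  proof -
    from that(1) obtain y where y: "y \<in> carrier_vec k" and x: "x = G\<^sup>T *\<^sub>v y"
      unfolding C_image by auto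
    have "x \<in> carrier_vec N" using GT y x by simp
    \<comment> \<open>The entries of this product are the inner products of x with the rows of
      \<open>G\<close>, and these rows are themselves codewords.\<close>
    have "G *\<^sub>v x = 0\<^sub>v k"
    proof (rule eq_vecI)
      fix i assume "i < dim_vec (0\<^sub>v k :: 'a vec)"
      then have i: "i < k" by simp
      then have "row G i \<in> set (cols G\<^sup>T)" using G by (simp add: rows_def)
      then have "row G i \<in> ?C" using in_own_span cols C_span by auto
      then have "x \<bullet> row G i = 0"
        using orth by (simp add: dual_code_def orthogonal_complement_def)
      moreover have "row G i \<bullet> x = x \<bullet> row G i"
        using G \<open>x \<in> carrier_vec N\<close> i by (intro comm_scalar_prod) auto
      ultimately show "(G *\<^sub>v x) $ i = 0\<^sub>v k $ i" using i G by simp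
    qed (use G in simp)
    then have "y = 0\<^sub>v k" using Gram_ker[OF y] x by simp
    then show ?thesis using x mult_mat_vec_zero[OF GT] by simp
  qed
  moreover have "0\<^sub>v N \<in> ?C"
    unfolding C_image using mult_mat_vec_zero[OF GT] by (auto intro!: bexI[of _ "0\<^sub>v k"])
  moreover have "0\<^sub>v N \<in> dual_code N ?C"
    unfolding dual_code_def orthogonal_complement_def C_image by auto
  ultimately show "LCD_code N ?C" unfolding LCD_code_def using sub by blast
qed

text \<open>Block multiplication of a row of two blocks with a column of two blocks. The lower
  blocks of height 0 become right blocks of width 0 after transposition, so only the upper left
  block of the product has entries.\<close>

lemma append_cols_mult_transpose:
  fixes A B :: "'a :: comm_semiring_0 mat"
  assumes A: "A \<in> carrier_mat nr nc1" and B: "B \<in> carrier_mat nr nc2"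
  shows "(A @\<^sub>c B) * (A @\<^sub>c B)\<^sup>T = A * A\<^sup>T + B * B\<^sup>T"
proof -
  have "(A @\<^sub>c B)\<^sup>T = four_block_mat A\<^sup>T (0\<^sub>m nc1 0) B\<^sup>T (0\<^sub>m nc2 0)"
    unfolding append_cols_def using A B
    by (subst transpose_four_block_mat[of _ nr nc1 _ nc2 _ 0]) auto
  moreover have "A @\<^sub>c B = four_block_mat A B (0\<^sub>m 0 nc1) (0\<^sub>m 0 nc2)"
    using A B by (simp add: append_cols_def)
  ultimately show ?thesis
    using A B by (simp add: mult_four_block_mat[of _ nr nc1 _ nc2 _ 0 _ _ nr _ 0]) (rule eq_matI, auto)
qed

text \<open>The defining equation lives over the complex numbers. Since the integers embed there
  injectively, it descends to an integer identity, which then maps into any commutative ring,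
  whatever its characteristic.\<close>

lemma weighing_matrix_mult_transpose:
  assumes "weighing_matrix n m W"
  shows "map_mat of_int W * (map_mat of_int W)\<^sup>T = of_nat m \<cdot>\<^sub>m (1\<^sub>m n :: 'a :: comm_ring_1 mat)"
proof -
  have W: "W \<in> carrier_mat n n" using assms by (simp add: weighing_matrix_def)
  let ?c = "map_mat of_int :: int mat \<Rightarrow> complex mat"
  let ?f = "map_mat of_int :: int mat \<Rightarrow> 'a mat"
  have WT: "W\<^sup>T \<in> carrier_mat n n" using W by simp
  have "?c (W * W\<^sup>T) = ?c W * (?c W)\<^sup>T"
    using of_int_hom.mat_hom_mult[OF W WT] by (simp add: map_mat_transpose)
  also have "\<dots> = of_nat m \<cdot>\<^sub>m 1\<^sub>m n"
    using assms by (simp add: weighing_matrix_def Let_def)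
  also have "\<dots> = ?c (of_nat m \<cdot>\<^sub>m 1\<^sub>m n)" by (rule eq_matI) auto
  finally have "W * W\<^sup>T = of_nat m \<cdot>\<^sub>m 1\<^sub>m n" by (rule of_int_hom.mat_hom_inj)
  then have "?f (W * W\<^sup>T) = ?f (of_nat m \<cdot>\<^sub>m 1\<^sub>m n)" by simp
  also have "\<dots> = of_nat m \<cdot>\<^sub>m 1\<^sub>m n" by (rule eq_matI) auto
  also have "?f (W * W\<^sup>T) = ?f W * (?f W)\<^sup>T"
    using of_int_hom.mat_hom_mult[OF W WT] by (simp add: map_mat_transpose)
  finally show ?thesis .
qed

theorem theorem3p8:
  fixes W :: "int mat" and n m :: nat
    and G :: "'a :: {field,finite} mat" and C :: "'a vec set"
  assumes "weighing_matrix n m W"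
    and "G = map_mat of_int W @\<^sub>c 1\<^sub>m n"
    and "C = generated_code G"
    and "of_nat m + 1 \<noteq> (0 :: 'a)"
  shows "LCD_code (2 * n) C \<and> code_dim (2 * n) C = n"
proof -
  have W: "map_mat of_int W \<in> carrier_mat n n"
    using assms(1) by (simp add: weighing_matrix_def)
  \<comment> \<open>The summand 0 is the height of the empty lower blocks.\<close>
  have "G \<in> carrier_mat (n + 0) (n + n)"
    unfolding assms(2) append_cols_def by (rule four_block_carrier_mat[OF W]) simp
  then have G: "G \<in> carrier_mat n (2 * n)" by (simp add: mult_2)
  have "G * G\<^sup>T = of_nat m \<cdot>\<^sub>m 1\<^sub>m n + 1\<^sub>m n"
    unfolding assms(2) append_cols_mult_transpose[OF W one_carrier_mat]
      weighing_matrix_mult_transpose[OF assms(1)] by simp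
  also have "\<dots> = (of_nat m + 1) \<cdot>\<^sub>m 1\<^sub>m n"
    by (rule eq_matI) auto
  \<comment> \<open>The determinant is the n-th power of m + 1, which is nonzero in a field.\<close>
  finally have "det (G * G\<^sup>T) \<noteq> 0" using assms(4) by (simp add: det_smult)
  then show ?thesis using Massey_LCD_criterion[OF G] assms(3) by blast
qed

end
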